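(* If $f(z)=z+\sum_{n=2}^{\infty}a_nz^n\in \mathcal{S}_{S,e}^*$, then $$|H_{2,2}(f^{-1})-H_{2,2}(f)|\leq\frac{1}{32}.$$
   Context: $\mathbb{D}=\{z\in\mathbb{C}:|z|<1\}$. $\mathcal{S}$ is the class of univalent (injective) analytic functions $f$ on $\mathbb{D}$ with expansion $f(z)=z+\sum_{n\ge 2}a_nz^n$. For analytic $g,h$ on $\mathbb{D}$, $g\prec h$ (subordination) means $g=h\circ w$ for some analytic $w:\mathbb{D}\to\mathbb{D}$ with $w(0)=0$. The class is $$\mathcal{S}_{S,e}^*=\left\{f\in\mathcal{S}:\ \frac{2zf'(z)}{f(z)-f(-z)}\prec e^z\right\}.$$ For $f\in\mathcal{S}$, the inverse function near $0$ is $f^{-1}(w)=w+A_2w^2+A_3w^3+A_4w^4+\cdots$. Set $H_{2,2}(f):=a_2a_4-a_3^2$ and $H_{2,2}(f^{-1}):=A_2A_4-A_3^2$. *)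

theory Defs
  imports "HOL-Complex_Analysis.Complex_Analysis"
begin

text \<open>
  Functions on the unit disc are total functions \<^typ>\<open>complex \<Rightarrow> complex\<close>; everything below
  depends only on their values on \<open>ball 0 1\<close>.
\<close>

abbreviation unit_disc :: "complex set" where
  "unit_disc \<equiv> ball 0 1"

definition subordinate :: "(complex \<Rightarrow> complex) \<Rightarrow> (complex \<Rightarrow> complex) \<Rightarrow> bool" where
  "subordinate g h \<longleftrightarrow>
     g holomorphic_on unit_disc \<and> h holomorphic_on unit_disc \<and>
     (\<exists>w. w holomorphic_on unit_disc \<and> w ` unit_disc \<subseteq> unit_disc \<and> w 0 = 0 \<and>
          (\<forall>z\<in>unit_disc. g z = h (w z)))"

text \<open>The two normalisations say that the Taylor expansion at 0 begins with \<open>z\<close>.\<close>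

definition class_S :: "(complex \<Rightarrow> complex) set" where
  "class_S = {f. f holomorphic_on unit_disc \<and> inj_on f unit_disc \<and> f 0 = 0 \<and> deriv f 0 = 1}"

text \<open>
  For \<open>f\<close> in \<^const>\<open>class_S\<close> the denominator \<open>f z - f (- z)\<close> vanishes on the disc only at
  \<open>z = 0\<close>, and this singularity of the quotient is removable with limit \<open>deriv f 0 = 1\<close>.
  The value there is given explicitly, since \<open>0 / 0 = 0\<close> in HOL.
\<close>

definition sakaguchi_quotient :: "(complex \<Rightarrow> complex) \<Rightarrow> complex \<Rightarrow> complex" where
  "sakaguchi_quotient f z =
     (if z = 0 then 1 else 2 * z * deriv f z / (f z - f (- z)))"

definition class_S_Se :: "(complex \<Rightarrow> complex) set" where
  "class_S_Se = {f \<in> class_S. subordinate (sakaguchi_quotient f) exp}"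

definition taylor_coeff :: "(complex \<Rightarrow> complex) \<Rightarrow> nat \<Rightarrow> complex" where
  "taylor_coeff f n = fps_nth (fps_expansion f 0) n"

definition hankel_2_2 :: "(complex \<Rightarrow> complex) \<Rightarrow> complex" where
  "hankel_2_2 f = taylor_coeff f 2 * taylor_coeff f 4 - (taylor_coeff f 3)\<^sup>2"

text \<open>
  For univalent \<open>f\<close> this is the inverse function on the open set \<open>f ` unit_disc\<close>, which is a
  neighbourhood of \<open>f 0 = 0\<close>; its values elsewhere do not affect its Taylor coefficients at 0.
\<close>

definition disc_inverse :: "(complex \<Rightarrow> complex) \<Rightarrow> complex \<Rightarrow> complex" where
  "disc_inverse f = inv_into unit_disc f"

end

theory Submission imports Defs begin

text \<open>
  Comparing coefficients in \<open>F\<^sup>-\<^sup>1 \<circ> F = X\<close> shows that the difference of the two Hankel determinants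
  is \<open>a\<^sub>2\<^sup>2 (a\<^sub>2\<^sup>2 - a\<^sub>3)\<close>. If \<open>w = c\<^sub>1 z + c\<^sub>2 z\<^sup>2 + \<dots>\<close> is the Schwarz function of the subordination,
  then \<open>2 a\<^sub>2 = c\<^sub>1\<close> and \<open>4 a\<^sub>3 = 2 c\<^sub>2 + c\<^sub>1\<^sup>2\<close>, so this difference equals \<open>- c\<^sub>1\<^sup>2 c\<^sub>2 / 8\<close>. The
  Schwarz--Pick inequality \<open>\<bar>c\<^sub>2\<bar> \<le> 1 - \<bar>c\<^sub>1\<bar>\<^sup>2\<close> and \<open>t (1 - t) \<le> 1/4\<close> give the bound.
\<close>

lemma fps_inverse_hankel_diff:
  fixes F G :: "'a :: comm_ring_1 fps"
  assumes comp: "G oo F = fps_X" and F0: "fps_nth F 0 = 0" and F1: "fps_nth F 1 = 1"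
  shows "(fps_nth G 2 * fps_nth G 4 - (fps_nth G 3)\<^sup>2) - (fps_nth F 2 * fps_nth F 4 - (fps_nth F 3)\<^sup>2)
           = (fps_nth F 2)\<^sup>2 * ((fps_nth F 2)\<^sup>2 - fps_nth F 3)"
proof -
  define a where "a = fps_nth F"
  define b where "b = fps_nth G"
  have a: "a 0 = 0" "a (Suc 0) = 1"
    using F0 F1 by (simp_all add: a_def)
  \<comment> \<open>Only \<open>n\<close> from 1 to 4 is used. As \<open>a 0 = 0\<close> and
    \<open>a 1 = 1\<close>, the \<open>n\<close>-th equation has \<open>b n\<close> with coefficient
    1 and otherwise only earlier \<open>b i\<close>, so the system is solved successively without
    division.\<close>
  have coeff: "(\<Sum>i=0..n. b i * fps_nth (F ^ i) n) = (if n = 1 then 1 else 0)" for n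
    using arg_cong[OF comp, of "\<lambda>H. fps_nth H n"] by (simp add: fps_compose_nth b_def fps_X_def)
  note expand = numeral_eq_Suc atLeast0_atMost_Suc fps_mult_nth a_def[symmetric] a
  have b1: "b 1 = 1"
    using coeff[of 1] by (simp add: expand)
  have b2: "b 2 = - a 2"
    using coeff[of 2] b1 by (simp add: expand add_eq_0_iff)
  have "a 3 + 2 * a 2 * b 2 + b 3 = 0"
    using coeff[of 3] b1 by (simp add: expand algebra_simps)
  hence b3: "b 3 = 2 * (a 2)\<^sup>2 - a 3"
    unfolding b2 by (simp add: power2_eq_square algebra_simps add_eq_0_iff eq_neg_iff_add_eq_0)
  have "a 4 + (2 * a 3 + (a 2)\<^sup>2) * b 2 + 3 * a 2 * b 3 + b 4 = 0"
    using coeff[of 4] b1 by (simp add: expand algebra_simps)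
  hence b4: "b 4 = 5 * a 2 * a 3 - 5 * a 2 ^ 3 - a 4"
    unfolding b2 b3 by (simp add: algebra_simps power2_eq_square power3_eq_cube eq_neg_iff_add_eq_0)
  \<comment> \<open>The terms \<open>a 2 * a 4\<close> and \<open>(a 3)\<^sup>2\<close> cancel, so
    the fourth coefficient disappears.\<close>
  show ?thesis
    unfolding a_def[symmetric] b_def[symmetric] b2 b3 b4
    by (simp add: algebra_simps power2_eq_square power3_eq_cube)
qed

text \<open>Following \<open>g\<close> by the disc automorphism that sends \<open>g 0\<close> to 0
  gives a map to which the Schwarz lemma applies; undoing the automorphism costs the factor
  \<open>1 - (norm (g 0))\<^sup>2\<close>.\<close>

lemma Schwarz_Pick_at_0:
  assumes holg: "g holomorphic_on ball 0 1" and g: "\<And>z. norm z < 1 \<Longrightarrow> norm (g z) < 1"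
  shows "norm (deriv g 0) \<le> 1 - (norm (g 0))\<^sup>2"
proof -
  define a where "a = g 0"
  define h where "h = Moebius_function 0 a \<circ> g"
  have a: "norm a < 1"
    using g[of 0] by (simp add: a_def)
  have hol: "h holomorphic_on ball 0 1"
    unfolding h_def using g
    by (intro holomorphic_on_compose_gen[OF holg Moebius_function_holomorphic[OF a]]) auto
  have h0: "h 0 = 0"
    by (simp add: h_def a_def Moebius_function_eq_zero)
  have h_less: "norm (h z) < 1" if "norm z < 1" for z
    using Moebius_function_norm_lt_1[OF a g[OF that]] by (simp add: h_def)
  have dh: "norm (deriv h 0) \<le> 1"
    using Schwarz_Lemma(2)[OF hol h0 h_less, of 0] by simp
  have denom: "1 - cnj a * g z \<noteq> 0" if "norm z < 1" for z
  proof -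
    have "norm (cnj a * g z) < 1"
      using a g[OF that] by (simp add: norm_mult_less[of "cnj a" 1 "g z" 1, simplified])
    thus ?thesis by auto
  qed
  have Dg: "(g has_field_derivative deriv g 0) (at 0)"
    and Dh: "(h has_field_derivative deriv h 0) (at 0)"
    using holomorphic_derivI[OF holg] holomorphic_derivI[OF hol] by auto
  \<comment> \<open>With the denominator cleared, the product rule at 0 replaces differentiating the
    Moebius map; since \<open>h 0 = 0\<close>, the term containing \<open>deriv g 0\<close> drops
    out on the left.\<close>
  have eq: "(1 - cnj a * g z) * h z = g z - a" if "norm z < 1" for z
    using denom[OF that] by (simp add: h_def Moebius_function_simple)
  have "((\<lambda>z. (1 - cnj a * g z) * h z) has_field_derivative
          (1 - cnj a * a) * deriv h 0) (at 0)"
    by (auto intro!: derivative_eq_intros Dg Dh simp: h0 a_def)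
  hence "((\<lambda>z. g z - a) has_field_derivative (1 - cnj a * a) * deriv h 0) (at 0)"
    by (rule has_field_derivative_transform_within_open[of _ _ _ "ball 0 1"]) (auto simp: eq)
  moreover have "((\<lambda>z. g z - a) has_field_derivative deriv g 0) (at 0)"
    by (auto intro!: derivative_eq_intros Dg)
  ultimately have "deriv g 0 = (1 - cnj a * a) * deriv h 0"
    using DERIV_unique by blast
  also have "1 - cnj a * a = of_real (1 - (norm a)\<^sup>2)"
    by (simp add: mult.commute flip: complex_norm_square)
  finally have "norm (deriv g 0) = \<bar>1 - (norm a)\<^sup>2\<bar> * norm (deriv h 0)"
    by (simp only: norm_mult norm_of_real)
  moreover have "(norm a)\<^sup>2 \<le> 1"
    using a by (simp add: power_le_one)
  ultimately show ?thesis
    using dh by (simp add: a_def mult_left_le)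
qed

text \<open>Apart from rotations, \<open>w z / z\<close> is again a self-map of the disc; its value
  and derivative at 0 are the first two coefficients of \<open>w\<close>, so Schwarz-Pick applies to
  it.\<close>

lemma Schwarz_second_coeff_bound:
  assumes hol: "w holomorphic_on ball 0 1" and w0: "w 0 = 0"
    and w_less: "\<And>z. norm z < 1 \<Longrightarrow> norm (w z) < 1" and W: "w has_fps_expansion W"
  shows "norm (fps_nth W 2) \<le> 1 - (norm (fps_nth W 1))\<^sup>2"
\<comment> \<open>This is the equality case of the Schwarz lemma: for a rotation the quotient has
  constant modulus 1 and leaves the open disc, but then both sides of the claim are 0.\<close>
proof (cases "\<exists>\<alpha>. (\<forall>z. norm z < 1 \<longrightarrow> w z = \<alpha> * z) \<and> norm \<alpha> = 1")
  case True
  then obtain \<alpha> where \<alpha>: "\<And>z. norm z < 1 \<Longrightarrow> w z = \<alpha> * z" "norm \<alpha> = 1" by blast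
  have "eventually (\<lambda>z. z \<in> ball 0 1) (nhds (0::complex))"
    by (rule eventually_nhds_in_open) auto
  hence "eventually (\<lambda>z. w z = \<alpha> * z) (nhds 0)"
    by eventually_elim (simp add: \<alpha>)
  moreover have "(\<lambda>z. \<alpha> * z) has_fps_expansion fps_const \<alpha> * fps_X"
    by (intro fps_expansion_intros)
  ultimately have "w has_fps_expansion fps_const \<alpha> * fps_X"
    using has_fps_expansion_cong by blast
  hence "W = fps_const \<alpha> * fps_X"
    using W fps_expansion_unique_complex by blast
  thus ?thesis using \<alpha>(2) by simp
next
  case False
  \<comment> \<open>The value at 0 fills the removable singularity of
    \<open>w z / z\<close>.\<close>
  define g where "g = (\<lambda>z. if z = 0 then deriv w 0 else w z / z)"
  have holg: "g holomorphic_on ball 0 1"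
    using pole_lemma_open[OF hol open_ball, of 0] unfolding g_def w0 diff_zero .
  have eq: "w z = z * g z" for z
    by (simp add: g_def w0)
  \<comment> \<open>Excluding rotations makes both Schwarz inequalities strict.\<close>
  have "norm (w z) < norm z" if "norm z < 1" "z \<noteq> 0" for z
    using Schwarz_Lemma(1,3)[OF hol w0 w_less that(1)] False that by (metis order_le_less)
  moreover have "norm (deriv w 0) < 1"
    using Schwarz_Lemma(2,3)[OF hol w0 w_less, of 0] False by (metis norm_zero order_le_less zero_less_one)
  ultimately have g_less: "norm (g z) < 1" if "norm z < 1" for z
    using that by (auto simp: g_def norm_divide)
  have G: "g has_fps_expansion fps_expansion g 0"
    using holg by (intro has_fps_expansion_fps_expansion[of "ball 0 1"]) auto
  have "(\<lambda>z. z * g z) has_fps_expansion fps_X * fps_expansion g 0"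
    by (intro fps_expansion_intros G)
  hence "w has_fps_expansion fps_X * fps_expansion g 0"
    by (simp flip: eq)
  hence "W = fps_X * fps_expansion g 0"
    using W fps_expansion_unique_complex by blast
  hence "fps_nth W 1 = g 0" "fps_nth W 2 = deriv g 0"
    by (simp_all add: fps_expansion_def numeral_2_eq_2)
  thus ?thesis
    using Schwarz_Pick_at_0[OF holg g_less] by simp
qed

text \<open>Subtracting \<open>F oo - fps_X\<close> kills the even coefficients of \<open>F\<close>
  and doubles the odd ones, so orders 2 and 3 read \<open>4 a2 = 2 c1\<close> and
  \<open>6 a3 = 2 e2 + 2 a3\<close>, where \<open>e2 = c2 + c1^2 / 2\<close> comes from the
  exponential.\<close>

lemma sakaguchi_exp_coeffs:
  fixes F W :: "'a :: field_char_0 fps"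
  assumes eq: "2 * (fps_X * fps_deriv F) = (F - (F oo - fps_X)) * (fps_exp 1 oo W)"
    and F0: "fps_nth F 0 = 0" and F1: "fps_nth F 1 = 1" and W0: "fps_nth W 0 = 0"
  shows "2 * fps_nth F 2 = fps_nth W 1"
    and "4 * fps_nth F 3 = 2 * fps_nth W 2 + (fps_nth W 1)\<^sup>2"
proof -
  define E where "E = fps_exp 1 oo W"
  have nth: "2 * (of_nat n * fps_nth F n)
      = (\<Sum>i=0..n. (1 - (-1) ^ i) * fps_nth F i * fps_nth E (n - i))" if "n > 0" for n
    using arg_cong[OF eq, of "\<lambda>H. fps_nth H n"] that
    by (simp add: numeral_fps_const fps_mult_nth[of _ E] fps_compose_uminus' E_def[symmetric]
          left_diff_distrib sum_subtractf)
  have E: "fps_nth E 0 = 1" "fps_nth E 1 = fps_nth W 1"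
      "fps_nth E 2 = fps_nth W 2 + (fps_nth W 1)\<^sup>2 / 2"
    by (simp_all add: E_def fps_compose_nth numeral_eq_Suc atLeast0_atMost_Suc fps_mult_nth W0)
  show "2 * fps_nth F 2 = fps_nth W 1"
    using nth[of 2] E F0 F1 by (simp add: numeral_eq_Suc atLeast0_atMost_Suc)
  have "2 * fps_nth F 3 = fps_nth E 2"
    using nth[of 3] E F0 F1 by (simp add: numeral_eq_Suc atLeast0_atMost_Suc)
  \<comment> \<open>Doubling clears the denominator in \<open>fps_nth E 2\<close>.\<close>
  hence "2 * (2 * fps_nth F 3) = 2 * fps_nth E 2"
    by (rule arg_cong)
  thus "4 * fps_nth F 3 = 2 * fps_nth W 2 + (fps_nth W 1)\<^sup>2"
    by (simp add: E(3) distrib_left)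
qed

lemma class_S_fps_expansion:
  assumes "f \<in> class_S"
  shows "f has_fps_expansion fps_expansion f 0"
    and "fps_nth (fps_expansion f 0) 0 = 0" and "fps_nth (fps_expansion f 0) 1 = 1"
proof -
  show "f has_fps_expansion fps_expansion f 0"
    using assms by (intro has_fps_expansion_fps_expansion[of unit_disc]) (auto simp: class_S_def)
qed (use assms in \<open>auto simp: class_S_def fps_expansion_def\<close>)

lemma hankel_inverse_diff:
  assumes "f \<in> class_S"
  shows "hankel_2_2 (disc_inverse f) - hankel_2_2 f
           = (taylor_coeff f 2)\<^sup>2 * ((taylor_coeff f 2)\<^sup>2 - taylor_coeff f 3)"
proof -
  have hol: "f holomorphic_on unit_disc" and inj: "inj_on f unit_disc" and f0: "f 0 = 0"
    using assms by (auto simp: class_S_def)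
  note F = class_S_fps_expansion[OF assms]
  \<comment> \<open>\<open>disc_inverse f\<close> is a pointwise choice; it inherits holomorphy from
    \<open>g\<close>, with which it agrees on the image. That image is open and contains 0, so the
    Taylor series there is a genuine expansion.\<close>
  obtain g where g: "g holomorphic_on f ` unit_disc" "\<And>z. z \<in> unit_disc \<Longrightarrow> g (f z) = z"
    using holomorphic_has_inverse[OF hol open_ball inj] by metis
  have inv: "disc_inverse f (f z) = z" if "z \<in> unit_disc" for z
    using inv_into_f_f[OF inj that] by (simp add: disc_inverse_def)
  have "disc_inverse f holomorphic_on f ` unit_disc"
    using g(1) by (rule holomorphic_transform) (use g(2) inv in auto)
  moreover have "open (f ` unit_disc)"
    using hol inj by (intro open_mapping_thm3) auto
  moreover have "0 \<in> f ` unit_disc"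
    using f0 by force
  ultimately have G: "disc_inverse f has_fps_expansion fps_expansion (disc_inverse f) 0"
    by (intro has_fps_expansion_fps_expansion)
  have "eventually (\<lambda>z. z \<in> unit_disc) (nhds (0::complex))"
    by (rule eventually_nhds_in_open) auto
  hence ev: "eventually (\<lambda>z. (disc_inverse f \<circ> f) z = z) (nhds 0)"
    by eventually_elim (simp add: inv)
  have "(disc_inverse f \<circ> f) has_fps_expansion fps_X"
    using has_fps_expansion_cong[OF ev refl] has_fps_expansion_fps_X by blast
  hence "fps_expansion (disc_inverse f) 0 oo fps_expansion f 0 = fps_X"
    using has_fps_expansion_compose[OF G F(1,2)] fps_expansion_unique_complex by blast
  from fps_inverse_hankel_diff[OF this F(2,3)] show ?thesis
    by (simp add: hankel_2_2_def taylor_coeff_def)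
qed

theorem corollary2p7:
  fixes f :: "complex \<Rightarrow> complex"
  assumes "f \<in> class_S_Se"
  shows "cmod (hankel_2_2 (disc_inverse f) - hankel_2_2 f) \<le> 1 / 32"
proof -
  have S: "f \<in> class_S"
    using assms by (simp add: class_S_Se_def)
  have inj: "inj_on f unit_disc" and f0: "f 0 = 0"
    using S by (auto simp: class_S_def)
  obtain w where w: "w holomorphic_on unit_disc" "w ` unit_disc \<subseteq> unit_disc" "w 0 = 0"
      "\<And>z. z \<in> unit_disc \<Longrightarrow> sakaguchi_quotient f z = exp (w z)"
    using assms by (auto simp: class_S_Se_def subordinate_def)
  define F where "F = fps_expansion f 0"
  define W where "W = fps_expansion w 0"
  note F = class_S_fps_expansion[OF S, folded F_def]
  have W: "w has_fps_expansion W"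
    unfolding W_def using w(1) by (intro has_fps_expansion_fps_expansion[of unit_disc]) auto
  have W0: "fps_nth W 0 = 0"
    by (simp add: W_def fps_expansion_def w(3))

  \<comment> \<open>Multiplied out, the relation also covers \<open>z = 0\<close>, where both sides
    vanish. Elsewhere \<open>z\<close> and \<open>- z\<close> differ, so injectivity keeps the
    denominator nonzero.\<close>
  have "2 * (z * deriv f z) = (f z - f (- z)) * exp (w z)" if z: "z \<in> unit_disc" for z
  proof (cases "z = 0")
    case False
    have "f z \<noteq> f (- z)"
      using inj_onD[OF inj, of z "- z"] z False by auto
    thus ?thesis
      using w(4)[OF z] False by (simp add: sakaguchi_quotient_def field_simps)
  qed (simp add: f0)
  moreover have "eventually (\<lambda>z. z \<in> unit_disc) (nhds (0::complex))"
    by (rule eventually_nhds_in_open) auto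
  ultimately have ev: "eventually (\<lambda>z. (f z - (f \<circ> uminus) z) * (exp \<circ> w) z = 2 * (z * deriv f z)) (nhds 0)"
    by (auto elim!: eventually_mono)
  have "(\<lambda>z. (f z - (f \<circ> uminus) z) * (exp \<circ> w) z) has_fps_expansion
          (F - (F oo - fps_X)) * (fps_exp 1 oo W)"
    by (intro fps_expansion_intros F(1) W W0) simp
  hence "(\<lambda>z. 2 * (z * deriv f z)) has_fps_expansion (F - (F oo - fps_X)) * (fps_exp 1 oo W)"
    using has_fps_expansion_cong[OF ev refl] by blast
  moreover have "(\<lambda>z. 2 * (z * deriv f z)) has_fps_expansion 2 * (fps_X * fps_deriv F)"
    by (intro fps_expansion_intros F(1))
  ultimately have eq: "2 * (fps_X * fps_deriv F) = (F - (F oo - fps_X)) * (fps_exp 1 oo W)"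
    using fps_expansion_unique_complex by blast
  note coeffs = sakaguchi_exp_coeffs[OF eq F(2,3) W0]

  define c where "c = fps_nth W 1"
  define d where "d = fps_nth W 2"
  have F2: "fps_nth F 2 = c / 2" and F3: "fps_nth F 3 = (2 * d + c\<^sup>2) / 4"
    using coeffs by (simp_all add: c_def d_def field_simps)
  \<comment> \<open>The \<open>c^4 / 16\<close> contributions cancel, leaving a single product to
    estimate.\<close>
  have "hankel_2_2 (disc_inverse f) - hankel_2_2 f = - (c\<^sup>2 * d) / 8"
    unfolding hankel_inverse_diff[OF S] taylor_coeff_def F_def[symmetric] F2 F3
    by (simp add: field_simps power2_eq_square)
  hence "cmod (hankel_2_2 (disc_inverse f) - hankel_2_2 f) = (cmod c)\<^sup>2 * cmod d / 8"
    by (simp add: norm_mult norm_power)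
  also have "(cmod c)\<^sup>2 * cmod d \<le> (cmod c)\<^sup>2 * (1 - (cmod c)\<^sup>2)"
    unfolding c_def d_def using w(2)
    by (intro mult_left_mono Schwarz_second_coeff_bound[OF w(1,3) _ W]) (auto simp: image_subset_iff)
  \<comment> \<open>With \<open>t = (cmod c)\<^sup>2\<close> this is
    \<open>(t - 1/2)^2 \<ge> 0\<close>; the remaining division by 8 yields 1/32.\<close>
  also have "\<dots> \<le> 1 / 4"
    using zero_le_power2[of "(cmod c)\<^sup>2 - 1 / 2"] by (simp add: power2_eq_square algebra_simps)
  finally show ?thesis by simp
qed

end
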